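(* For every finite graph $G$, $B(G)\le B'(G)$.
   Context: For a graph $G$, the bandwidth $B(G)$ is the minimum, over all assignments $g$ of distinct integers to the vertices of $G$, of $\max_{uv\in E(G)}|g(u)-g(v)|$. An edge-numbering of $G$ is an assignment $f$ of distinct integers to the edges of $G$; $B'(f)$ is the maximum of $|f(e)-f(e')|$ over pairs of distinct edges $e,e'$ that are incident (share an endpoint). The edge-bandwidth $B'(G)$ is the minimum of $B'(f)$ over all edge-numberings $f$ of $G$ (equivalently, the bandwidth of the line graph of $G$).
   Formalization: The inequality is proved for finite simple graphs that are edgeless or have two incident edges; graphs whose edges form a nonempty matching (e.g. a single edge, where B = 1 but B' is a maximum over no pairs, taken as 0) are excluded because the claim fails there. *)

theory Defs
  imports Complex_Main
begin

definition simple_graph :: "'a set \<Rightarrow> 'a set set \<Rightarrow> bool" where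
  "simple_graph V E \<longleftrightarrow> finite V \<and> (\<forall>e\<in>E. e \<subseteq> V \<and> card e = 2)"

text \<open>
  The differences below are nonnegative, so inserting 0 only fixes the value of the
  maximum when there is no edge, respectively no pair of incident edges.
\<close>

definition vertex_numbering_width :: "'a set set \<Rightarrow> ('a \<Rightarrow> int) \<Rightarrow> nat" where
  "vertex_numbering_width E g = Max (insert 0 {nat \<bar>g u - g v\<bar> | u v. {u, v} \<in> E})"

definition bandwidth :: "'a set \<Rightarrow> 'a set set \<Rightarrow> nat" where
  "bandwidth V E = (LEAST k. \<exists>g. inj_on g V \<and> k = vertex_numbering_width E g)"

definition incident_edges :: "'a set \<Rightarrow> 'a set \<Rightarrow> bool" where
  "incident_edges e e' \<longleftrightarrow> e \<noteq> e' \<and> e \<inter> e' \<noteq> {}"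

definition edge_numbering_width :: "'a set set \<Rightarrow> ('a set \<Rightarrow> int) \<Rightarrow> nat" where
  "edge_numbering_width E f =
     Max (insert 0 {nat \<bar>f e - f e'\<bar> | e e'. e \<in> E \<and> e' \<in> E \<and> incident_edges e e'})"

definition edge_bandwidth :: "'a set set \<Rightarrow> nat" where
  "edge_bandwidth E = (LEAST k. \<exists>f. inj_on f E \<and> k = edge_numbering_width E f)"

text \<open>
  A nonempty matching, e.g. a single edge, has bandwidth at least 1, but its edge-bandwidth
  is a maximum over the empty set, so the inequality between the two cannot hold for it.
\<close>

lemma matching_edge_bandwidth_less_bandwidth:
  assumes G: "simple_graph V E" and ne: "E \<noteq> {}"
    and matching: "\<not> (\<exists>e\<in>E. \<exists>e'\<in>E. incident_edges e e')"
  shows "edge_bandwidth E < bandwidth V E"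
proof -
  have finV: "finite V" using G by (simp add: simple_graph_def)
  have "E \<subseteq> Pow V" using G by (auto simp: simple_graph_def)
  then have finE: "finite E" using finV by (meson finite_Pow_iff finite_subset)
  obtain f :: "'a set \<Rightarrow> nat" where f: "inj_on f E"
    using finE finite_imp_inj_to_nat_seg by metis
  have empty: "{nat \<bar>h e - h e'\<bar> | e e'. e \<in> E \<and> e' \<in> E \<and> incident_edges e e'} = {}"
    for h :: "'a set \<Rightarrow> int"
    using matching by blast
  have w: "edge_numbering_width E (int \<circ> f) = 0"
    unfolding edge_numbering_width_def empty by simp
  have "inj_on (int \<circ> f) E" using f by (auto simp: inj_on_def)
  then have "\<exists>f. inj_on f E \<and> 0 = edge_numbering_width E f" using w by metis
  then have eb: "edge_bandwidth E = 0" unfolding edge_bandwidth_def by (rule Least_eq_0)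
  obtain g0 :: "'a \<Rightarrow> nat" where g0: "inj_on g0 V"
    using finV finite_imp_inj_to_nat_seg by metis
  then have "inj_on (int \<circ> g0) V" by (auto simp: inj_on_def)
  then have "\<exists>k g. inj_on g V \<and> k = vertex_numbering_width E g" by blast
  then have "\<exists>g. inj_on g V \<and> bandwidth V E = vertex_numbering_width E g"
    unfolding bandwidth_def by (rule LeastI_ex)
  then obtain g where g: "inj_on g V" "bandwidth V E = vertex_numbering_width E g" by blast
  obtain e where e: "e \<in> E" using ne by blast
  then have "e \<subseteq> V" "card e = 2" using G by (auto simp: simple_graph_def)
  then obtain u v where uv: "e = {u, v}" "u \<noteq> v" "u \<in> V" "v \<in> V"
    by (auto simp: card_2_iff)
  let ?D = "{nat \<bar>g u - g v\<bar> | u v. {u, v} \<in> E}"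
  have "?D \<subseteq> (\<lambda>(u, v). nat \<bar>g u - g v\<bar>) ` (V \<times> V)"
    using \<open>E \<subseteq> Pow V\<close> by fastforce
  then have "finite ?D" using finV by (meson finite_SigmaI finite_imageI finite_subset)
  moreover have "nat \<bar>g u - g v\<bar> \<in> insert 0 ?D" using e uv by blast
  ultimately have "nat \<bar>g u - g v\<bar> \<le> vertex_numbering_width E g"
    unfolding vertex_numbering_width_def by (intro Max_ge) auto
  moreover have "g u \<noteq> g v" using g(1) uv by (auto dest: inj_onD)
  ultimately show ?thesis using eb g(2) by linarith
qed

end

theory Submission imports Defs begin

text \<open>
  Let f be an edge-numbering of width k > 0. In a component with smallest edge a, injectivity of f
  yields an end r of a that lies on no edge labelled f(a) + k. The other vertices v of the component
  can be assigned distinct incident edges p(v), by growing a tree from r; choose p with the sum of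
  the labels f(p(v)) minimal. Put g(r) = f(a) - 1 and g(v) = f(p(v)). For an edge e = uv avoiding
  r, either e is p(u) or p(v), so that p(u) and p(v) share an end, or e is not used by p, and
  minimality forces both f(p(u)) and f(p(v)) into [f(e) - k, f(e)]. For an edge e = rv the same
  argument gives f(a) \<le> g(v) \<le> f(e) < f(a) + k, which leaves room for g(r) = f(a) - 1.
\<close>

section \<open>Systems of distinct incident edges\<close>

text \<open>Modelled on a tree rooted at \<open>r\<close> in which every other vertex picks the edge
  to its parent. Only distinctness and incidence are kept, because exchanging a single edge can
  destroy the tree.\<close>

definition edge_choice :: "'a set set \<Rightarrow> 'a \<Rightarrow> 'a set \<Rightarrow> ('a \<Rightarrow> 'a set) \<Rightarrow> bool" where
  "edge_choice E r C p \<longleftrightarrow> inj_on p (C - {r}) \<and> (\<forall>v\<in>C - {r}. v \<in> p v \<and> p v \<in> E \<and> p v \<subseteq> C)"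

text \<open>Take a maximal \<open>C\<close> carrying a choice: an edge leaving \<open>C\<close>
  could be given to its outer end, enlarging \<open>C\<close>. \<open>C\<close> may exceed the
  component of \<open>r\<close>, for instance by a disjoint cycle; later steps use only its closure
  under adjacency.\<close>

lemma edge_choice_exists:
  assumes "finite V" "r \<in> V" "\<forall>e\<in>E. e \<subseteq> V \<and> card e = 2"
  obtains C p where "r \<in> C" "C \<subseteq> V" "edge_choice E r C p"
    "\<And>u v. {u, v} \<in> E \<Longrightarrow> u \<in> C \<Longrightarrow> v \<in> C"
proof -
  let ?S = "{C. r \<in> C \<and> C \<subseteq> V \<and> (\<exists>p. edge_choice E r C p)}"
  have "finite ?S" using assms(1) by simp
  moreover have "{r} \<in> ?S" using assms(2) by (simp add: edge_choice_def)
  ultimately have "\<exists>C\<in>?S. \<forall>D\<in>?S. C \<subseteq> D \<longrightarrow> C = D" by (intro finite_has_maximal) auto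
  then obtain C where C: "C \<in> ?S" and max: "\<And>D. D \<in> ?S \<Longrightarrow> C \<subseteq> D \<Longrightarrow> C = D"
    by (elim bexE) simp
  then obtain p where p: "edge_choice E r C p" by blast
  have "v \<in> C" if e: "{u, v} \<in> E" and u: "u \<in> C" for u v
  proof (rule ccontr)
    assume v: "v \<notin> C"
    let ?q = "p(v := {u, v})"
    \<comment> \<open>Chosen edges lie inside \<open>C\<close>, while \<open>v\<close> does not, so
      the new edge is still free.\<close>
    have "{u, v} \<notin> p ` (C - {r})" using p v by (auto simp: edge_choice_def)
    moreover have "r \<noteq> v" using C v by auto
    ultimately have "edge_choice E r (insert v C) ?q"
      using p e u v unfolding edge_choice_def inj_on_def by auto
    moreover have "insert v C \<subseteq> V" using C e assms(3) by auto
    ultimately have "insert v C \<in> ?S" using C by blast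
    then show False using max[of "insert v C"] v by blast
  qed
  then show ?thesis using that[of C p] C p by blast
qed

lemma minimal_edge_choice:
  fixes f :: "'a set \<Rightarrow> int"
  assumes "finite C" "edge_choice E r C p0" "\<And>e. e \<in> E \<Longrightarrow> m \<le> f e"
  obtains p where "edge_choice E r C p"
    "\<And>e v. e \<in> E \<Longrightarrow> e \<subseteq> C \<Longrightarrow> e \<notin> p ` (C - {r}) \<Longrightarrow> v \<in> e \<Longrightarrow> v \<in> C - {r} \<Longrightarrow> f (p v) \<le> f e"
proof -
  \<comment> \<open>Labels may be negative; subtracting the lower bound \<open>m\<close> gives
    natural weights, so a least one exists and \<open>nat\<close> truncates nothing on edges of
    \<open>E\<close>.\<close>
  define w where "w = (\<lambda>p. \<Sum>v\<in>C - {r}. nat (f (p v) - m))"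
  obtain p where p: "edge_choice E r C p" and least: "\<And>q. edge_choice E r C q \<Longrightarrow> w p \<le> w q"
    using ex_has_least_nat[of "edge_choice E r C" p0 w] assms(2) by blast
  have "f (p v) \<le> f e"
    if e: "e \<in> E" "e \<subseteq> C" "e \<notin> p ` (C - {r})" and v: "v \<in> e" "v \<in> C - {r}" for e v
  proof -
    let ?q = "p(v := e)"
    have "edge_choice E r C ?q"
      using p e v unfolding edge_choice_def inj_on_def by auto
    then have "w p \<le> w ?q" by (rule least)
    moreover have "w q = nat (f (q v) - m) + (\<Sum>x\<in>C - {r} - {v}. nat (f (q x) - m))" for q
      unfolding w_def using assms(1) v by (simp add: sum.remove)
    moreover have "(\<Sum>x\<in>C - {r} - {v}. nat (f (?q x) - m)) = (\<Sum>x\<in>C - {r} - {v}. nat (f (p x) - m))"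
      by (rule sum.cong) auto
    ultimately have "nat (f (p v) - m) \<le> nat (f e - m)" by simp
    then show ?thesis using assms(3)[OF e(1)] by linarith
  qed
  then show ?thesis using that p by blast
qed

text \<open>At most one edge has label \<open>f a + k\<close>. If it met both ends of
  \<open>a\<close> it would equal \<open>a\<close>, which \<open>k > 0\<close> forbids.\<close>

lemma edge_end_avoiding_label:
  fixes f :: "'a set \<Rightarrow> int"
  assumes "inj_on f E" "card a = 2" "k > 0" "\<forall>e\<in>E. card e = 2"
  obtains r where "r \<in> a" "\<And>e. e \<in> E \<Longrightarrow> r \<in> e \<Longrightarrow> f e \<noteq> f a + k"
proof (rule ccontr)
  assume "\<not> thesis"
  then have bad: "\<forall>x\<in>a. \<exists>e\<in>E. x \<in> e \<and> f e = f a + k" using that by blast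
  obtain x y where xy: "a = {x, y}" "x \<noteq> y" using assms(2) by (auto simp: card_2_iff)
  obtain e where e: "e \<in> E" "x \<in> e" "f e = f a + k" using bad xy by blast
  obtain e' where e': "e' \<in> E" "y \<in> e'" "f e' = f a + k" using bad xy by blast
  have "e = e'" using inj_onD[OF assms(1)] e e' by metis
  then have "a \<subseteq> e" using e e' xy by blast
  moreover have "card e = 2" using e assms(4) by blast
  ultimately have "a = e" using assms(2) by (metis card_subset_eq card.infinite zero_neq_numeral)
  then show False using e assms(3) by simp
qed

section \<open>From edge labels to vertex numbers\<close>

lemma component_numbering:
  fixes f :: "'a set \<Rightarrow> int"
  assumes V: "finite V" and E: "\<forall>e\<in>E. e \<subseteq> V \<and> card e = 2" and inj: "inj_on f E"
    and k: "k > 0" and "E \<noteq> {}"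
    and close: "\<And>e e'. e \<in> E \<Longrightarrow> e' \<in> E \<Longrightarrow> e \<inter> e' \<noteq> {} \<Longrightarrow> \<bar>f e - f e'\<bar> \<le> k"
  obtains C and g :: "'a \<Rightarrow> int" where "C \<noteq> {}" "C \<subseteq> V" "inj_on g C"
    "\<And>u v. {u, v} \<in> E \<Longrightarrow> u \<in> C \<Longrightarrow> v \<in> C \<and> \<bar>g u - g v\<bar> \<le> k"
proof -
  have "E \<subseteq> Pow V" using E by blast
  then have "finite E" using V by (meson finite_Pow_iff finite_subset)
  \<comment> \<open>The minimum is over all of \<open>E\<close>: \<open>f a\<close> is the bound
    \<open>m\<close> for the weights, and \<open>f a - 1\<close> is below every label, hence free
    for the root.\<close>
  then obtain a where a: "a \<in> E" and least: "\<And>e. e \<in> E \<Longrightarrow> f a \<le> f e"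
    using \<open>E \<noteq> {}\<close> by (metis arg_min_least arg_min_if_finite(1))
  obtain r where r: "r \<in> a" and avoid: "\<And>e. e \<in> E \<Longrightarrow> r \<in> e \<Longrightarrow> f e \<noteq> f a + k"
    using edge_end_avoiding_label[of f E a k] inj E a k by blast
  have "r \<in> V" using r a E by blast
  then obtain C p0 where C: "r \<in> C" "C \<subseteq> V" and p0: "edge_choice E r C p0"
    and closed: "\<And>u v. {u, v} \<in> E \<Longrightarrow> u \<in> C \<Longrightarrow> v \<in> C"
    using edge_choice_exists[OF V _ E] by metis
  have "finite C" using C V finite_subset by blast
  then obtain p where p: "edge_choice E r C p"
    and minimal: "\<And>e v. e \<in> E \<Longrightarrow> e \<subseteq> C \<Longrightarrow> e \<notin> p ` (C - {r}) \<Longrightarrow> v \<in> e \<Longrightarrow> v \<in> C - {r} \<Longrightarrow> f (p v) \<le> f e"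
    using minimal_edge_choice[of C E r p0 "f a" f] p0 least by metis
  have pE: "p v \<in> E" "v \<in> p v" if "v \<in> C" "v \<noteq> r" for v
    using p that by (auto simp: edge_choice_def)
  define g where "g = (\<lambda>v. if v = r then f a - 1 else f (p v))"
  have "inj_on g C"
  proof (rule inj_onI)
    fix x y assume xy: "x \<in> C" "y \<in> C" "g x = g y"
    have "f a \<le> f (p v)" if "v \<in> C" "v \<noteq> r" for v using least pE that by blast
    then have "x = r \<longleftrightarrow> y = r" using xy unfolding g_def by (smt (verit))
    moreover have "x = y" if "x \<noteq> r" "y \<noteq> r"
    proof -
      have "p x = p y" using xy that pE inj unfolding g_def by (auto dest: inj_onD)
      then show ?thesis using p xy that unfolding edge_choice_def by (auto dest: inj_onD)
    qed
    ultimately show "x = y" by blast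
  qed
  moreover have root: "\<bar>g r - g v\<bar> \<le> k" if e: "{r, v} \<in> E" and v: "v \<in> C" "v \<noteq> r" for v
  proof -
    have "f (p v) \<le> f {r, v}"
    proof (cases "p v = {r, v}")
      case False
      have "{r, v} \<noteq> p w" if "w \<in> C - {r}" for w using pE[of w] that False by auto
      then show ?thesis using minimal[OF e] C v by blast
    qed simp
    moreover have "f {r, v} \<le> f a + k" using close[OF e a] r by auto
    \<comment> \<open>The choice of \<open>r\<close> sharpens the bound to
      \<open>f a + k - 1\<close>, at distance at most \<open>k\<close> from
      \<open>g r = f a - 1\<close>.\<close>
    moreover have "f {r, v} \<noteq> f a + k" using avoid[OF e] by simp
    moreover have "f a \<le> f (p v)" using least pE v by blast
    ultimately show ?thesis using v by (simp add: g_def)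
  qed
  moreover have inner: "\<bar>g u - g v\<bar> \<le> k"
    if e: "{u, v} \<in> E" and u: "u \<in> C" "u \<noteq> r" and v: "v \<in> C" "v \<noteq> r" for u v
  proof -
    have cu: "\<bar>f {u, v} - f (p u)\<bar> \<le> k" using close[OF e] pE u by blast
    have cv: "\<bar>f {u, v} - f (p v)\<bar> \<le> k" using close[OF e] pE v by blast
    show ?thesis
    proof (cases "{u, v} = p u \<or> {u, v} = p v")
      case True
      \<comment> \<open>If \<open>p u\<close> is the edge itself, \<open>cv\<close> is the claim;
        symmetrically for \<open>p v\<close> and \<open>cu\<close>.\<close>
      then show ?thesis using cu cv u v by (auto simp: g_def)
    next
      case False
      then have "{u, v} \<noteq> p w" if "w \<in> C - {r}" for w
        using pE(2)[of w] that by (metis DiffD1 DiffD2 empty_iff insert_iff)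
      then have "{u, v} \<notin> p ` (C - {r})" by blast
      \<comment> \<open>Without this, \<open>cu\<close> and \<open>cv\<close> would only give
        \<open>2 * k\<close>; minimality puts both labels on the same side of
        \<open>f {u, v}\<close>.\<close>
      then have "f (p u) \<le> f {u, v}" "f (p v) \<le> f {u, v}"
        using minimal[OF e, of u] minimal[OF e, of v] u v by simp_all
      then show ?thesis using cu cv u v by (simp add: g_def)
    qed
  qed
  moreover have "v \<in> C \<and> \<bar>g u - g v\<bar> \<le> k" if e: "{u, v} \<in> E" and u: "u \<in> C" for u v
  proof -
    have v: "v \<in> C" using closed e u by blast
    have "u \<noteq> v" using E e by fastforce
    then show ?thesis
      using root[of v] root[of u] inner[of u v] e u v by (metis abs_minus_commute insert_commute)
  qed
  ultimately show ?thesis using that[of C g] C by blast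
qed

text \<open>No edge joins the closed set \<open>C\<close> to its complement, so the complement is
  numbered by induction, with \<open>f\<close> restricted to its edges, and the two numberings are
  placed side by side.\<close>

lemma vertex_numbering_of_edge_numbering:
  fixes f :: "'a set \<Rightarrow> int"
  assumes "finite V" and "\<forall>e\<in>E. e \<subseteq> V \<and> card e = 2" and "inj_on f E" and "k > 0"
    and "\<And>e e'. e \<in> E \<Longrightarrow> e' \<in> E \<Longrightarrow> e \<inter> e' \<noteq> {} \<Longrightarrow> \<bar>f e - f e'\<bar> \<le> k"
  shows "\<exists>g :: 'a \<Rightarrow> int. inj_on g V \<and> (\<forall>u v. {u, v} \<in> E \<longrightarrow> \<bar>g u - g v\<bar> \<le> k)"
  using assms
proof (induction V arbitrary: E rule: finite_psubset_induct)
  case (psubset V)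
  show ?case
  proof (cases "E = {}")
    \<comment> \<open>This includes the case of empty \<open>V\<close>, which admits no edge of two
      elements.\<close>
    case True
    obtain h :: "'a \<Rightarrow> nat" where "inj_on h V"
      using psubset.hyps finite_imp_inj_to_nat_seg by metis
    then have "inj_on (int \<circ> h) V" by (auto simp: inj_on_def)
    then show ?thesis using True by blast
  next
    case False
    obtain C and g :: "'a \<Rightarrow> int" where C: "C \<noteq> {}" "C \<subseteq> V" and g: "inj_on g C"
      and edge: "\<And>u v. {u, v} \<in> E \<Longrightarrow> u \<in> C \<Longrightarrow> v \<in> C \<and> \<bar>g u - g v\<bar> \<le> k"
    proof (rule component_numbering[of V E f k])
      show "\<bar>f e - f e'\<bar> \<le> k" if "e \<in> E" "e' \<in> E" "e \<inter> e' \<noteq> {}" for e e'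
        using psubset.prems(4) that by blast
    qed (use psubset.hyps psubset.prems(1-3) False in auto)
    let ?F = "{e \<in> E. e \<subseteq> V - C}"
    have "V - C \<subset> V" using C by blast
    moreover have "\<forall>e\<in>?F. e \<subseteq> V - C \<and> card e = 2" using psubset.prems(1) by blast
    moreover have "inj_on f ?F" using psubset.prems(2) by (rule inj_on_subset) auto
    ultimately have "\<exists>h :: 'a \<Rightarrow> int. inj_on h (V - C) \<and> (\<forall>u v. {u, v} \<in> ?F \<longrightarrow> \<bar>h u - h v\<bar> \<le> k)"
      using psubset.prems(3,4) by (intro psubset.IH) auto
    then obtain h :: "'a \<Rightarrow> int" where h: "inj_on h (V - C)"
      and hedge: "\<And>u v. {u, v} \<in> ?F \<Longrightarrow> \<bar>h u - h v\<bar> \<le> k"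
      by blast
    obtain M where M: "\<And>v. v \<in> V \<Longrightarrow> g v \<le> M"
      using bdd_above_finite[of "g ` V"] psubset.hyps by (auto simp: bdd_above_def)
    obtain N where N: "\<And>v. v \<in> V \<Longrightarrow> N \<le> h v"
      using bdd_below_finite[of "h ` V"] psubset.hyps by (auto simp: bdd_below_def)
    \<comment> \<open>Translation keeps differences; \<open>h v - N\<close> is nonnegative, so the
      shifted values start at \<open>M + 1\<close>, above all values of \<open>g\<close> on
      \<open>C\<close>.\<close>
    define j where "j = (\<lambda>v. if v \<in> C then g v else h v - N + M + 1)"
    have sep: "j x \<noteq> j y" if "x \<in> C" "y \<in> V - C" for x y
      using M[of x] N[of y] that C unfolding j_def by auto
    have "inj_on j V"
    proof (rule inj_onI)
      fix x y assume xy: "x \<in> V" "y \<in> V" "j x = j y"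
      then consider "x \<in> C" "y \<in> C" | "x \<notin> C" "y \<notin> C" using sep by (metis DiffI)
      then show "x = y"
      proof cases
        case 1
        then show ?thesis using xy g by (auto simp: j_def dest: inj_onD)
      next
        case 2
        then have "h x = h y" using xy by (simp add: j_def)
        then show ?thesis using xy 2 h by (auto dest: inj_onD)
      qed
    qed
    moreover have "\<bar>j u - j v\<bar> \<le> k" if e: "{u, v} \<in> E" for u v
    proof (cases "u \<in> C")
      case True
      then show ?thesis using edge[OF e] by (simp add: j_def)
    next
      case False
      then have v: "v \<notin> C" using edge[of v u] e by (auto simp: insert_commute)
      then have "{u, v} \<in> ?F" using e False psubset.prems(1) by blast
      then show ?thesis using hedge[of u v] False v by (simp add: j_def)
    qed
    ultimately show ?thesis by blast
  qed
qed

section \<open>Bandwidths as minima of maxima\<close>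

lemma edge_bandwidth_attained:
  assumes "finite E"
  obtains f where "inj_on f E" "edge_bandwidth E = edge_numbering_width E f"
proof -
  obtain h :: "'a set \<Rightarrow> nat" where "inj_on h E"
    using assms finite_imp_inj_to_nat_seg by metis
  then have "inj_on (int \<circ> h) E" by (auto simp: inj_on_def)
  then have "\<exists>k f. inj_on f E \<and> k = edge_numbering_width E f" by blast
  then have "\<exists>f. inj_on f E \<and> edge_bandwidth E = edge_numbering_width E f"
    unfolding edge_bandwidth_def by (rule LeastI_ex)
  then show ?thesis using that by blast
qed

lemma edge_numbering_width_ge:
  assumes "finite E" "e \<in> E" "e' \<in> E" "incident_edges e e'"
  shows "nat \<bar>f e - f e'\<bar> \<le> edge_numbering_width E f"
proof -
  let ?D = "{nat \<bar>f e - f e'\<bar> | e e'. e \<in> E \<and> e' \<in> E \<and> incident_edges e e'}"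
  have "?D \<subseteq> (\<lambda>(e, e'). nat \<bar>f e - f e'\<bar>) ` (E \<times> E)" by fastforce
  then have "finite ?D" using assms(1) by (meson finite_SigmaI finite_imageI finite_subset)
  then show ?thesis
    unfolding edge_numbering_width_def using assms(2-4) by (intro Max_ge) auto
qed

lemma bandwidth_le:
  assumes G: "simple_graph V E" and g: "inj_on g V"
    and edge: "\<And>u v. {u, v} \<in> E \<Longrightarrow> \<bar>g u - g v\<bar> \<le> int k"
  shows "bandwidth V E \<le> k"
proof -
  let ?D = "{nat \<bar>g u - g v\<bar> | u v. {u, v} \<in> E}"
  have "?D \<subseteq> (\<lambda>(u, v). nat \<bar>g u - g v\<bar>) ` (V \<times> V)"
    using G unfolding simple_graph_def by fastforce
  then have "finite ?D"
    using G unfolding simple_graph_def by (meson finite_SigmaI finite_imageI finite_subset)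
  moreover have "d \<le> k" if "d \<in> ?D" for d using that edge by fastforce
  ultimately have "vertex_numbering_width E g \<le> k"
    unfolding vertex_numbering_width_def by (subst Max_le_iff) auto
  moreover have "bandwidth V E \<le> vertex_numbering_width E g"
    unfolding bandwidth_def using g by (intro Least_le) blast
  ultimately show ?thesis by linarith
qed

text \<open>An incident pair makes \<open>edge_bandwidth E\<close> positive, as the construction
  requires of \<open>k\<close>. What is excluded are the nonempty matchings of
  \<open>matching_edge_bandwidth_less_bandwidth\<close>.\<close>

theorem theorem7:
  fixes V :: "'a set" and E :: "'a set set"
  assumes "simple_graph V E"
    and "E = {} \<or> (\<exists>e\<in>E. \<exists>e'\<in>E. incident_edges e e')"
  shows "bandwidth V E \<le> edge_bandwidth E"
proof -
  have V: "finite V" and E: "\<forall>e\<in>E. e \<subseteq> V \<and> card e = 2"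
    using assms(1) by (auto simp: simple_graph_def)
  have "E \<subseteq> Pow V" using E by blast
  then have finE: "finite E" using V by (meson finite_Pow_iff finite_subset)
  then obtain f where f: "inj_on f E" and k: "edge_bandwidth E = edge_numbering_width E f"
    by (rule edge_bandwidth_attained)
  have ge: "\<bar>f e - f e'\<bar> \<le> int (edge_bandwidth E)"
    if "e \<in> E" "e' \<in> E" "incident_edges e e'" for e e'
    using edge_numbering_width_ge[OF finE that, of f] k by linarith
  show ?thesis
  proof (cases "E = {}")
    case True
    obtain h :: "'a \<Rightarrow> nat" where "inj_on h V"
      using V finite_imp_inj_to_nat_seg by metis
    then have "inj_on (int \<circ> h) V" by (auto simp: inj_on_def)
    then show ?thesis using True by (intro bandwidth_le[OF assms(1)]) auto
  next
    case False
    then obtain e e' where e: "e \<in> E" "e' \<in> E" "incident_edges e e'" using assms(2) by blast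
    then have "f e \<noteq> f e'" using f by (auto simp: incident_edges_def dest: inj_onD)
    then have "int (edge_bandwidth E) > 0" using ge[OF e] by linarith
    moreover have "\<bar>f e - f e'\<bar> \<le> int (edge_bandwidth E)"
      if "e \<in> E" "e' \<in> E" "e \<inter> e' \<noteq> {}" for e e'
      using ge[of e e'] that by (cases "e = e'") (auto simp: incident_edges_def)
    ultimately obtain g :: "'a \<Rightarrow> int" where "inj_on g V"
      "\<And>u v. {u, v} \<in> E \<Longrightarrow> \<bar>g u - g v\<bar> \<le> int (edge_bandwidth E)"
      using vertex_numbering_of_edge_numbering[OF V E f] by metis
    then show ?thesis using bandwidth_le[OF assms(1)] by blast
  qed
qed

end
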